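(* Let $c>0$ and let $\varphi(r)=(r^2+c^2)^{3/2}$, $r\ge 0$, be the generalised multiquadric function. Let $\lambda_j$, $j\in\mathbb{Z}$, be the (finitely many nonzero) Fourier coefficients of $(1-\cos\xi)^2$, i.e. $$(1-\cos\xi)^2=\tfrac14e^{-2i\xi}-e^{-i\xi}+\tfrac32-e^{i\xi}+\tfrac14e^{2i\xi},$$ and let $\psi:\mathbb{R}\to\mathbb{R}$ be the quasi-Lagrange function $$\psi(x)=\sum_{j\in\mathbb{Z}}\lambda_j\varphi(|x-j|)=\tfrac14\varphi(|x+2|)-\varphi(|x+1|)+\tfrac32\varphi(|x|)-\varphi(|x-1|)+\tfrac14\varphi(|x-2|).$$ Then $$|\psi(x)|=O\big((1+|x|)^{-5}\big),$$ i.e. there is a constant $C$ (depending on $c$) such that $|\psi(x)|\le C(1+|x|)^{-5}$ for all $x\in\mathbb{R}$.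
   Context: The space dimension is $1$. In terms of the Fourier transform $\hat f(\xi)=\int_{\mathbb{R}} f(x)e^{-i\xi x}\,dx$ (in the generalised sense for $\varphi(|\cdot|)$), the quasi-Lagrange function is given by $\hat\psi(\xi)=(1-\cos\xi)^2\hat\varphi(|\xi|)$. *)

theory Defs
  imports "HOL-Analysis.Analysis"
begin

definition gen_multiquadric :: "real \<Rightarrow> real \<Rightarrow> real" where
  "gen_multiquadric c r = (r\<^sup>2 + c\<^sup>2) powr (3 / 2)"

definition fourier_coeff :: "(real \<Rightarrow> complex) \<Rightarrow> int \<Rightarrow> complex" where
  "fourier_coeff f j = integral {-pi..pi} (\<lambda>\<xi>. f \<xi> * exp (- \<i> * of_int j * of_real \<xi>)) / (2 * pi)"

text \<open>The coefficients of \<open>(1 - cos \<xi>)\<^sup>2\<close> are real and even in \<open>j\<close>, so the real part loses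
  nothing, and the sign convention in the exponent is immaterial;
  see \<open>fourier_coeff_one_minus_cos_sq\<close> below.\<close>

definition quasi_lagrange_coeff :: "int \<Rightarrow> real" where
  "quasi_lagrange_coeff j = Re (fourier_coeff (\<lambda>\<xi>. of_real ((1 - cos \<xi>)\<^sup>2)) j)"

definition quasi_lagrange :: "real \<Rightarrow> real \<Rightarrow> real" where
  "quasi_lagrange c x =
     (\<Sum>\<^sub>\<infinity>j::int. quasi_lagrange_coeff j * gen_multiquadric c \<bar>x - of_int j\<bar>)"

lemma one_minus_cos_sq_expansion:
  fixes \<xi> :: real
  shows "complex_of_real ((1 - cos \<xi>)\<^sup>2) =
    1/4 * exp (- 2 * \<i> * of_real \<xi>) - exp (- \<i> * of_real \<xi>) + 3/2
      - exp (\<i> * of_real \<xi>) + 1/4 * exp (2 * \<i> * of_real \<xi>)"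
proof -
  define z where "z = exp (\<i> * complex_of_real \<xi>)"
  define w where "w = exp (- (\<i> * complex_of_real \<xi>))"
  have zw: "z * w = 1"
    by (simp add: z_def w_def exp_minus)
  have c: "complex_of_real (cos \<xi>) = (z + w) / 2"
    by (simp add: z_def w_def cos_of_real[symmetric] cos_exp_eq)
  have z2: "exp (2 * \<i> * complex_of_real \<xi>) = z\<^sup>2"
    by (simp add: z_def exp_double[symmetric] mult.assoc)
  have w2: "exp (- 2 * \<i> * complex_of_real \<xi>) = w\<^sup>2"
    by (simp add: w_def exp_double[symmetric] mult.assoc)
  have "(1 - (z + w) / 2)\<^sup>2 = 1/4 * w\<^sup>2 - w + (1 + z * w / 2) - z + 1/4 * z\<^sup>2"
    by (simp add: power2_eq_square field_simps)
  also have "1 + z * w / 2 = 3/2"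
    by (simp add: zw)
  finally show ?thesis
    unfolding z2 w2 by (simp add: c z_def[symmetric] w_def[symmetric])
qed

lemma has_integral_exp_int:
  fixes k :: int
  shows "((\<lambda>\<xi>. exp (\<i> * of_int k * of_real \<xi>)) has_integral (if k = 0 then 2 * pi else 0)) {-pi..pi}"
proof (cases "k = 0")
  case True
  then show ?thesis
    using has_integral_const_real[of "1::complex" "-pi" pi] by (simp add: scaleR_conv_of_real)
next
  case False
  define F where "F = (\<lambda>\<xi>::real. exp (\<i> * of_int k * of_real \<xi>) / (\<i> * of_int k))"
  have d: "(F has_vector_derivative exp (\<i> * of_int k * of_real t)) (at t within S)" for t S
    unfolding F_def
    by (rule has_vector_derivative_real_field)
       (use False in \<open>auto intro!: derivative_eq_intros simp: field_simps\<close>)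
  have "((\<lambda>\<xi>. exp (\<i> * of_int k * of_real \<xi>)) has_integral (F pi - F (-pi))) {-pi..pi}"
    by (rule fundamental_theorem_of_calculus) (use d in auto)
  moreover have "exp (\<i> * of_int k * of_real pi) = exp (\<i> * of_int k * of_real (-pi))"
    unfolding exp_eq by (rule exI[of _ k]) (simp add: algebra_simps)
  ultimately show ?thesis
    using False by (simp add: F_def)
qed

lemma fourier_coeff_one_minus_cos_sq:
  "fourier_coeff (\<lambda>\<xi>. of_real ((1 - cos \<xi>)\<^sup>2)) j =
     (if j = 0 then 3/2 else if \<bar>j\<bar> = 1 then -1 else if \<bar>j\<bar> = 2 then 1/4 else 0)"
proof -
  define e where "e = (\<lambda>k \<xi>. exp (\<i> * of_int k * complex_of_real \<xi>))"
  define I where "I = (\<lambda>k::int. complex_of_real (if k = 0 then 2 * pi else 0))"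
  have hI: "(e k has_integral I k) {-pi..pi}" for k
    using has_integral_exp_int[of k] unfolding e_def I_def by simp
  have eq: "of_real ((1 - cos \<xi>)\<^sup>2) * exp (- \<i> * of_int j * complex_of_real \<xi>) =
      1/4 * e (-2 - j) \<xi> - e (-1 - j) \<xi> + 3/2 * e (-j) \<xi> - e (1 - j) \<xi> + 1/4 * e (2 - j) \<xi>" for \<xi>
    unfolding one_minus_cos_sq_expansion e_def
    by (simp add: distrib_right left_diff_distrib mult.assoc exp_add[symmetric])
       (simp add: algebra_simps)
  have "((\<lambda>\<xi>. 1/4 * e (-2 - j) \<xi> - e (-1 - j) \<xi> + 3/2 * e (-j) \<xi> - e (1 - j) \<xi> + 1/4 * e (2 - j) \<xi>)
      has_integral (1/4 * I (-2 - j) - I (-1 - j) + 3/2 * I (-j) - I (1 - j) + 1/4 * I (2 - j))) {-pi..pi}"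
    by (intro has_integral_add has_integral_diff has_integral_mult_right hI)
  then have "fourier_coeff (\<lambda>\<xi>. of_real ((1 - cos \<xi>)\<^sup>2)) j =
      (1/4 * I (-2 - j) - I (-1 - j) + 3/2 * I (-j) - I (1 - j) + 1/4 * I (2 - j)) / (2 * pi)"
    unfolding fourier_coeff_def eq by (simp add: integral_unique)
  then show ?thesis
    by (auto simp: I_def abs_if)
qed

lemma quasi_lagrange_coeff_eq:
  "quasi_lagrange_coeff j =
     (if j = 0 then 3/2 else if \<bar>j\<bar> = 1 then -1 else if \<bar>j\<bar> = 2 then 1/4 else 0)"
  unfolding quasi_lagrange_coeff_def fourier_coeff_one_minus_cos_sq by simp

lemma quasi_lagrange_explicit:
  "quasi_lagrange c x =
     1/4 * gen_multiquadric c \<bar>x + 2\<bar> - gen_multiquadric c \<bar>x + 1\<bar>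
       + 3/2 * gen_multiquadric c \<bar>x\<bar>
       - gen_multiquadric c \<bar>x - 1\<bar> + 1/4 * gen_multiquadric c \<bar>x - 2\<bar>"
proof -
  have "quasi_lagrange c x =
      (\<Sum>\<^sub>\<infinity>j\<in>{-2,-1,0,1,2::int}. quasi_lagrange_coeff j * gen_multiquadric c \<bar>x - of_int j\<bar>)"
    unfolding quasi_lagrange_def
    by (rule infsum_cong_neutral)
       (auto simp: quasi_lagrange_coeff_eq abs_if split: if_splits)
  then show ?thesis
    by (simp add: quasi_lagrange_coeff_eq)
qed

end

theory Submission
  imports Defs
begin

text \<open>
  The symbol \<open>(1 - cos \<xi>)\<^sup>2 = (2 - 2 cos \<xi>)\<^sup>2 / 4\<close> is a quarter of the symbol of the fourth central
  difference, so \<open>\<psi>(x)\<close> is a quarter of the fourth difference of \<open>\<phi>\<close> over the nodes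
  \<open>x - 2, \<dots>, x + 2\<close>, and hence equals \<open>\<phi>''''(t) / 4\<close> for some \<open>t\<close> with \<open>\<bar>t - x\<bar> \<le> 2\<close>
  (\<open>forward_diff_funpow_mean_value\<close>).

  The decay comes from a cancellation in the fourth derivative. As \<open>x \<rightarrow> \<plusminus>\<infinity>\<close>, the expansion
  \<open>\<phi>(x) = \<bar>x\<bar>\<^sup>3 + (3/2) c\<^sup>2 \<bar>x\<bar> + (3/8) c\<^sup>4 / \<bar>x\<bar> + \<dots>\<close> starts with two terms that are
  cubic polynomials on each half-line, and the first surviving term has a fourth derivative of order
  \<open>\<bar>x\<bar>\<close> to the power \<open>-5\<close>. In closed form, \<open>\<phi>''''(x) = 9 c\<^sup>4 / (sqrt (x\<^sup>2 + c\<^sup>2))^5\<close>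
  (\<open>gen_multiquadric_derivatives\<close>). Since \<open>t\<close> stays within distance 2 of \<open>x\<close>, the denominator at \<open>t\<close>
  is comparable to \<open>(1 + \<bar>x\<bar>)^5\<close>.
\<close>

definition forward_diff :: "(real \<Rightarrow> real) \<Rightarrow> real \<Rightarrow> real" where
  "forward_diff f x = f (x + 1) - f x"

text \<open>
  Differencing commutes with differentiation. Hence the differences \<open>forward_diff (F m)\<close> again form a
  chain of successive derivatives, to which the induction hypothesis applies; the ordinary mean value
  theorem removes the one difference that remains.
\<close>

lemma forward_diff_funpow_mean_value:
  assumes "\<And>m x. m < n \<Longrightarrow> (F m has_real_derivative F (Suc m) x) (at x)"
  shows "\<exists>t\<ge>x. t \<le> x + real n \<and> (forward_diff ^^ n) (F 0) x = F n t"
  using assms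
proof (induction n arbitrary: F)
  case 0
  show ?case by auto
next
  case (Suc n)
  have "((\<lambda>x. forward_diff (F m) x) has_real_derivative forward_diff (F (Suc m)) x) (at x)"
    if "m < n" for m x
    unfolding forward_diff_def using that
    by (intro DERIV_diff DERIV_shift[THEN iffD1] Suc.prems) auto
  from Suc.IH[of "\<lambda>m. forward_diff (F m)", OF this]
  obtain t where t: "x \<le> t" "t \<le> x + real n"
    "(forward_diff ^^ n) (forward_diff (F 0)) x = F n (t + 1) - F n t"
    unfolding forward_diff_def[of "F n"] by blast
  obtain s where "t < s" "s < t + 1" "F n (t + 1) - F n t = (t + 1 - t) * F (Suc n) s"
    using MVT2[of t "t + 1" "F n" "F (Suc n)"] Suc.prems[of n] by auto
  with t show ?case
    by (intro exI[of _ s]) (auto simp: funpow_Suc_right simp del: funpow.simps)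
qed

lemma gen_multiquadric_eq_sqrt_cubed:
  assumes "c > 0"
  shows "gen_multiquadric c x = (sqrt (x\<^sup>2 + c\<^sup>2)) ^ 3"
proof -
  have "x\<^sup>2 + c\<^sup>2 > 0"
    using assms by (simp add: add_nonneg_pos)
  then have "(x\<^sup>2 + c\<^sup>2) powr (3/2) = ((x\<^sup>2 + c\<^sup>2) powr (1/2)) powr real 3"
    by (simp add: powr_powr)
  also have "\<dots> = (sqrt (x\<^sup>2 + c\<^sup>2)) ^ 3"
    using \<open>x\<^sup>2 + c\<^sup>2 > 0\<close> by (subst powr_realpow) (auto simp: powr_half_sqrt)
  finally show ?thesis
    by (simp add: gen_multiquadric_def)
qed

lemma quasi_lagrange_eq_fourth_difference:
  "quasi_lagrange c x = (forward_diff ^^ 4) (gen_multiquadric c) (x - 2) / 4"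
  unfolding quasi_lagrange_explicit
  by (simp add: forward_diff_def eval_nat_numeral gen_multiquadric_def add.commute)

text \<open>
  With \<open>r = sqrt (x\<^sup>2 + c\<^sup>2)\<close> one has \<open>r' = x / r\<close>, so every derivative of \<open>r\<^sup>3\<close> is a rational
  function of \<open>x\<close> and \<open>r\<close>. The last numerator collapses to a constant: it is
  \<open>9 r\<^sup>4 - 18 x\<^sup>2 r\<^sup>2 + 9 x\<^sup>4 = 9 (r\<^sup>2 - x\<^sup>2)\<^sup>2 = 9 c\<^sup>4\<close>.
\<close>

lemma gen_multiquadric_derivatives:
  fixes c x :: real
  assumes "c > 0"
  defines "r \<equiv> \<lambda>x. sqrt (x\<^sup>2 + c\<^sup>2)"
  shows "((\<lambda>x. r x ^ 3) has_real_derivative 3 * x * r x) (at x)"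
    and "((\<lambda>x. 3 * x * r x) has_real_derivative 3 * r x + 3 * x\<^sup>2 / r x) (at x)"
    and "((\<lambda>x. 3 * r x + 3 * x\<^sup>2 / r x) has_real_derivative 9 * x / r x - 3 * x ^ 3 / r x ^ 3) (at x)"
    and "((\<lambda>x. 9 * x / r x - 3 * x ^ 3 / r x ^ 3) has_real_derivative 9 * c ^ 4 / r x ^ 5) (at x)"
proof -
  have pos: "x\<^sup>2 + c\<^sup>2 > 0"
    using assms by (simp add: add_nonneg_pos)
  then have r: "r x \<noteq> 0" and sq: "c\<^sup>2 = (r x)\<^sup>2 - x\<^sup>2"
    by (auto simp: r_def)
  have d [derivative_intros]: "(r has_real_derivative x / r x) (at x)"
    unfolding r_def using pos by (auto intro!: derivative_eq_intros simp: field_simps)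
  show "((\<lambda>x. r x ^ 3) has_real_derivative 3 * x * r x) (at x)"
    using r by (auto intro!: derivative_eq_intros simp: power2_eq_square)
  show "((\<lambda>x. 3 * x * r x) has_real_derivative 3 * r x + 3 * x\<^sup>2 / r x) (at x)"
    using r by (auto intro!: derivative_eq_intros simp: power2_eq_square)
  show "((\<lambda>x. 3 * r x + 3 * x\<^sup>2 / r x) has_real_derivative 9 * x / r x - 3 * x ^ 3 / r x ^ 3) (at x)"
    using r by (auto intro!: derivative_eq_intros simp: field_simps eval_nat_numeral)
  have "c ^ 4 = ((r x)\<^sup>2 - x\<^sup>2)\<^sup>2"
    unfolding sq[symmetric] by simp
  then have "9 * c ^ 4 / r x ^ 5 = 9 / r x - 18 * x\<^sup>2 / r x ^ 3 + 9 * x ^ 4 / r x ^ 5"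
    using r by (simp add: field_simps eval_nat_numeral)
  moreover have "((\<lambda>x. 9 * x / r x - 3 * x ^ 3 / r x ^ 3) has_real_derivative
      9 / r x - 18 * x\<^sup>2 / r x ^ 3 + 9 * x ^ 4 / r x ^ 5) (at x)"
    using r by (auto intro!: derivative_eq_intros simp: field_simps eval_nat_numeral)
  ultimately show "((\<lambda>x. 9 * x / r x - 3 * x ^ 3 / r x ^ 3) has_real_derivative 9 * c ^ 4 / r x ^ 5) (at x)"
    by simp
qed

lemma quasi_lagrange_mean_value:
  assumes "c > 0"
  shows "\<exists>t. \<bar>t - x\<bar> \<le> 2 \<and> quasi_lagrange c x = 9 / 4 * c ^ 4 / sqrt (t\<^sup>2 + c\<^sup>2) ^ 5"
proof -
  define r where "r = (\<lambda>x. sqrt (x\<^sup>2 + c\<^sup>2))"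
  define F :: "nat \<Rightarrow> real \<Rightarrow> real" where
    "F m = [\<lambda>x. r x ^ 3, \<lambda>x. 3 * x * r x, \<lambda>x. 3 * r x + 3 * x\<^sup>2 / r x,
            \<lambda>x. 9 * x / r x - 3 * x ^ 3 / r x ^ 3, \<lambda>x. 9 * c ^ 4 / r x ^ 5] ! m" for m
  have "(F m has_real_derivative F (Suc m) y) (at y)" if "m < 4" for m y
  proof -
    from that consider "m = 0" | "m = 1" | "m = 2" | "m = 3"
      by linarith
    then show ?thesis
      by cases (use gen_multiquadric_derivatives[OF assms, of y]
                in \<open>simp_all add: F_def r_def eval_nat_numeral\<close>)
  qed
  then obtain t where t: "t \<ge> x - 2" "t \<le> x - 2 + real 4"
      "(forward_diff ^^ 4) (F 0) (x - 2) = F 4 t"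
    using forward_diff_funpow_mean_value[of 4 F "x - 2"] by blast
  have "F 0 = gen_multiquadric c"
    by (auto simp: F_def r_def gen_multiquadric_eq_sqrt_cubed[OF assms])
  with t have "quasi_lagrange c x = 9 / 4 * c ^ 4 / sqrt (t\<^sup>2 + c\<^sup>2) ^ 5"
    by (simp add: quasi_lagrange_eq_fourth_difference F_def r_def)
  with t show ?thesis
    by (intro exI[of _ t]) auto
qed

theorem theorem6:
  fixes c :: real
  assumes "c > 0"
  shows "\<exists>C::real. \<forall>x::real. \<bar>quasi_lagrange c x\<bar> \<le> C * (1 + \<bar>x\<bar>) powr (-5)"
proof (intro exI allI)
  fix x :: real
  define K where "K = 1 + 3 / c"
  obtain t where t: "\<bar>t - x\<bar> \<le> 2"
      and eq: "quasi_lagrange c x = 9 / 4 * c ^ 4 / sqrt (t\<^sup>2 + c\<^sup>2) ^ 5"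
    using quasi_lagrange_mean_value[OF assms] by blast
  define r where "r = sqrt (t\<^sup>2 + c\<^sup>2)"
  have r: "\<bar>t\<bar> \<le> r" "c \<le> r"
    unfolding r_def by (auto intro: real_le_rsqrt)
  \<comment> \<open>\<open>K\<close> is chosen so that the two lower bounds for \<open>r\<close> absorb \<open>\<bar>t\<bar>\<close> and the constant 3.\<close>
  have "1 + \<bar>x\<bar> \<le> \<bar>t\<bar> + 3"
    using t by linarith
  also have "\<dots> \<le> r + 3 / c * r"
    using r assms by (intro add_mono) (auto simp: field_simps)
  finally have le: "1 + \<bar>x\<bar> \<le> K * r"
    by (simp add: K_def algebra_simps)
  have "r > 0"
    using r assms by linarith
  have "(1 + \<bar>x\<bar>) ^ 5 \<le> K ^ 5 * r ^ 5"
    using power_mono[OF le, of 5] by (simp add: power_mult_distrib)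
  then have "1 / r ^ 5 \<le> K ^ 5 / (1 + \<bar>x\<bar>) ^ 5"
    using \<open>r > 0\<close> by (simp add: field_simps)
  then have "9 / 4 * c ^ 4 * (1 / r ^ 5) \<le> 9 / 4 * c ^ 4 * (K ^ 5 / (1 + \<bar>x\<bar>) ^ 5)"
    using assms by (intro mult_left_mono) auto
  moreover have "(1 + \<bar>x\<bar>) powr (-5) = 1 / (1 + \<bar>x\<bar>) ^ 5"
    using powr_realpow[of "1 + \<bar>x\<bar>" 5] by (simp add: powr_minus_divide)
  ultimately show "\<bar>quasi_lagrange c x\<bar> \<le> 9 / 4 * c ^ 4 * (1 + 3 / c) ^ 5 * (1 + \<bar>x\<bar>) powr (-5)"
    using assms \<open>r > 0\<close> by (simp add: eq r_def[symmetric] K_def)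
qed

end
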